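(* Let $(X(A),r)$ be the one-sided golden mean shift with its unique strongly invariant probability measure $\rho$. Let $m_0$ be the function on $X(A)$ determined by $$m_0(11\dots)=\sqrt2,\qquad m_0(21\dots)=0,\qquad m_0(12\dots)=1$$ (i.e. $m_0$ depends only on the first two letters), and let $C$ be the cycle $\{111\dots\}$ (of length $p=1$). Then $m_0$ satisfies $$\frac{1}{\#r^{-1}(x)}\sum_{y\in r^{-1}(x)}|m_0(y)|^2=1\quad(x\in X(A)),\qquad m_0(111\dots)=\sqrt{\#r^{-1}(r(111\dots))},$$ and it defines a scaling vector $\hat\varphi\in L^2(X_\infty,\lambda_C)$, namely $$\hat\varphi(x,\omega)=\prod_{k=1}^\infty\frac{m_0(z_k)}{\sqrt{\#r^{-1}(r(z_k))}},\qquad x\in X(A),\ \omega=(z_k)_{k\ge1}\in\mathbf N_C(x),$$ which satisfies $U\hat\varphi=\pi(m_0)\hat\varphi$, with $h_C=1$.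
   Context: Let $I=\{1,2\}$ and $A=\begin{pmatrix}1&1\\1&0\end{pmatrix}$. $X(A)$ is the set of one-sided sequences $x_0x_1x_2\dots\in I^{\mathbb N_0}$ with $A(x_i,x_{i+1})=1$ for all $i\ge0$ (no two consecutive letters $2$), with the product topology, and $r(x_0x_1x_2\dots)=x_1x_2x_3\dots$. Thus $r^{-1}(x)=\{ix\,|\,A(i,x_0)=1\}$. $\rho$ is the unique Borel probability measure on $X(A)$ with $\int f\,d\rho=\int\frac1{\#r^{-1}(x)}\sum_{r(y)=x}f(y)\,d\rho(x)$ for all $f\in C(X(A))$ (existence and uniqueness are known). A path starting at $x$ is a sequence $\omega=(z_1,z_2,\dots)$ in $X(A)$ with $r(z_1)=x$, $r(z_{n+1})=z_n$; $\Omega_x$ is the set of such paths and $X_\infty=\bigcup_x\Omega_x$ (elements also written $(x,\omega)$; $X_\infty$ is identified with the two-sided subshift of sequences $(x_i)_{i\in\mathbb Z}$ with $A(x_i,x_{i+1})=1$, where $z_k=x_{-k}x_{-k+1}x_{-k+2}\dots$). $\hat r(x,(z_1,z_2,\dots))=(r(x),(x,z_1,z_2,\dots))$. $\mathbf N_C(x)=\{(z_k)\in\Omega_x\,|\,\lim_kz_k=111\dots\}$. The measure $\lambda_C$ on $X_\infty$ is $\int f\,d\lambda_C=\int_{X(A)}\sum_{\omega\in\mathbf N_C(x)}f(\omega)\,d\rho(x)$. On $L^2(X_\infty,\lambda_C)$: $U\xi(x,\omega)=\sqrt{\#r^{-1}(r(x))}\,\xi(\hat r(x,\omega))$ (all phases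 $\alpha_i$ are set equal to $1$) and $\pi(f)\xi(x,\omega)=f(x)\xi(x,\omega)$. With $W(x)=|m_0(x)|^2/\#r^{-1}(r(x))$, $P_x$ is the probability measure on $\Omega_x$ with $P_x(\{(z_k)\,|\,z_1=a_1,\dots,z_n=a_n\})=\prod_{k=1}^nW(a_k)$ for $(a_k)\in\Omega_x$, and $h_C(x):=P_x(\mathbf N_C(x))$. *)

theory Defs
  imports "HOL-Analysis.Analysis" "HOL-Probability.Probability_Measure"
begin

section \<open>The golden mean shift\<close>

definition letters :: "nat set" where
  "letters = {1, 2}"

definition golden_A :: "nat \<Rightarrow> nat \<Rightarrow> nat" where
  "golden_A i j = (if i = 2 \<and> j = 2 then 0 else 1)"

text \<open>
  Sequences carry the product topology of the discrete topology on \<^typ>\<open>nat\<close>,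
  which is the topology of the library instance on \<^typ>\<open>nat \<Rightarrow> nat\<close>.
\<close>

definition XA :: "(nat \<Rightarrow> nat) set" where
  "XA = {x. \<forall>i. x i \<in> letters \<and> golden_A (x i) (x (Suc i)) = 1}"

definition r :: "(nat \<Rightarrow> nat) \<Rightarrow> (nat \<Rightarrow> nat)" where
  "r x = (\<lambda>i. x (Suc i))"

definition preimages :: "(nat \<Rightarrow> nat) \<Rightarrow> (nat \<Rightarrow> nat) set" where
  "preimages x = {y \<in> XA. r y = x}"

definition ones :: "nat \<Rightarrow> nat" where
  "ones = (\<lambda>_. 1)"

definition strongly_invariant :: "(nat \<Rightarrow> nat) measure \<Rightarrow> bool" where
  "strongly_invariant \<rho> \<longleftrightarrow>
     prob_space \<rho> \<and> sets \<rho> = sets (restrict_space borel XA) \<and>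
     (\<forall>f :: (nat \<Rightarrow> nat) \<Rightarrow> complex. continuous_on XA f \<longrightarrow>
        (LINT x|\<rho>. f x) =
        (LINT x|\<rho>. 1 / of_nat (card (preimages x)) * (\<Sum>y\<in>preimages x. f y)))"


section \<open>Paths and the measure on the solenoid\<close>

text \<open>
  A path \<open>(z\<^sub>1, z\<^sub>2, \<dots>)\<close> is represented by \<open>\<omega>\<close> with \<open>\<omega> k = z\<^sub>k\<^sub>+\<^sub>1\<close>.
\<close>

type_synonym path = "nat \<Rightarrow> nat \<Rightarrow> nat"

definition paths :: "(nat \<Rightarrow> nat) \<Rightarrow> path set" where
  "paths x = {\<omega>. (\<forall>n. \<omega> n \<in> XA) \<and> r (\<omega> 0) = x \<and> (\<forall>n. r (\<omega> (Suc n)) = \<omega> n)}"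

definition X_inf :: "((nat \<Rightarrow> nat) \<times> path) set" where
  "X_inf = (SIGMA x:XA. paths x)"

definition r_hat :: "(nat \<Rightarrow> nat) \<times> path \<Rightarrow> (nat \<Rightarrow> nat) \<times> path" where
  "r_hat = (\<lambda>(x, \<omega>). (r x, case_nat x \<omega>))"

definition N_C :: "(nat \<Rightarrow> nat) \<Rightarrow> path set" where
  "N_C x = {\<omega> \<in> paths x. \<omega> \<longlonglongrightarrow> ones}"

text \<open>
  The measure is given by its values \<open>E \<mapsto> \<integral> #{\<omega> \<in> N_C x. (x, \<omega>) \<in> E} d\<rho>(x)\<close> on Borel sets.
  That this set function really is a measure, and that the integral formula for arbitrary
  integrands holds, is proved below as \<open>nn_integral_lambda_C\<close>.
\<close>

definition lambda_C :: "(nat \<Rightarrow> nat) measure \<Rightarrow> ((nat \<Rightarrow> nat) \<times> path) measure" where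
  "lambda_C \<rho> = measure_of X_inf (sets (restrict_space borel X_inf))
     (\<lambda>E. \<integral>\<^sup>+x. (\<integral>\<^sup>+\<omega>. indicator E (x, \<omega>) \<partial>count_space (N_C x)) \<partial>\<rho>)"

text \<open>
  Elements of \<open>L\<^sup>2\<close> are represented by square integrable functions; equality in \<open>L\<^sup>2\<close> is equality
  almost everywhere.
\<close>

definition square_integrable :: "'a measure \<Rightarrow> ('a \<Rightarrow> complex) \<Rightarrow> bool" where
  "square_integrable M \<xi> \<longleftrightarrow>
     \<xi> \<in> borel_measurable M \<and> integrable M (\<lambda>z. (cmod (\<xi> z))\<^sup>2)"

definition U_op :: "((nat \<Rightarrow> nat) \<times> path \<Rightarrow> complex) \<Rightarrow> (nat \<Rightarrow> nat) \<times> path \<Rightarrow> complex" where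
  "U_op \<xi> = (\<lambda>(x, \<omega>). complex_of_real (sqrt (card (preimages (r x)))) * \<xi> (r_hat (x, \<omega>)))"

definition pi_op :: "((nat \<Rightarrow> nat) \<Rightarrow> complex) \<Rightarrow>
    ((nat \<Rightarrow> nat) \<times> path \<Rightarrow> complex) \<Rightarrow> (nat \<Rightarrow> nat) \<times> path \<Rightarrow> complex" where
  "pi_op f \<xi> = (\<lambda>(x, \<omega>). f x * \<xi> (x, \<omega>))"


section \<open>The filter, the scaling vector and the path measures\<close>

definition m0 :: "(nat \<Rightarrow> nat) \<Rightarrow> complex" where
  "m0 x = (if x 0 = 1 \<and> x 1 = 1 then complex_of_real (sqrt 2)
           else if x 0 = 1 \<and> x 1 = 2 then 1 else 0)"

text \<open>
  The complement of \<open>{(x, \<omega>). \<omega> \<in> N_C x}\<close> is a null set for \<open>lambda_C \<rho>\<close>; the value \<open>0\<close> there is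
  a choice of representative.
\<close>

definition phi_hat :: "((nat \<Rightarrow> nat) \<Rightarrow> complex) \<Rightarrow> (nat \<Rightarrow> nat) \<times> path \<Rightarrow> complex" where
  "phi_hat m = (\<lambda>(x, \<omega>).
     if \<omega> \<in> N_C x
     then (\<Prod>k. m (\<omega> k) / complex_of_real (sqrt (card (preimages (r (\<omega> k))))))
     else 0)"

definition W :: "((nat \<Rightarrow> nat) \<Rightarrow> complex) \<Rightarrow> (nat \<Rightarrow> nat) \<Rightarrow> real" where
  "W m x = (cmod (m x))\<^sup>2 / card (preimages (r x))"

definition is_path_measure ::
    "((nat \<Rightarrow> nat) \<Rightarrow> complex) \<Rightarrow> (nat \<Rightarrow> nat) \<Rightarrow> path measure \<Rightarrow> bool" where
  "is_path_measure m x P \<longleftrightarrow>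
     prob_space P \<and> sets P = sets (restrict_space borel (paths x)) \<and>
     (\<forall>a\<in>paths x. \<forall>n. measure P {\<omega> \<in> paths x. \<forall>k<n. \<omega> k = a k} = (\<Prod>k<n. W m (a k)))"

definition path_measure ::
    "((nat \<Rightarrow> nat) \<Rightarrow> complex) \<Rightarrow> (nat \<Rightarrow> nat) \<Rightarrow> path measure" where
  "path_measure m x = (THE P. is_path_measure m x P)"

definition h_C :: "((nat \<Rightarrow> nat) \<Rightarrow> complex) \<Rightarrow> (nat \<Rightarrow> nat) \<Rightarrow> real" where
  "h_C m x = measure (path_measure m x) (N_C x)"


section \<open>The integral formula for the measure on the solenoid\<close>

text \<open>
  Paths ending in the cycle are enumerated by the countably many words \<open>w\<close> that are eventually \<open>1\<close>:
  \<open>z\<^sub>k\<^sub>+\<^sub>1 = w k \<dots> w 0 x 0 x 1 \<dots>\<close>.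
\<close>

definition glue :: "(nat \<Rightarrow> nat) \<Rightarrow> (nat \<Rightarrow> nat) \<Rightarrow> path" where
  "glue w x k = (\<lambda>i. if i \<le> k then w (k - i) else x (i - Suc k))"

definition ev_ones :: "(nat \<Rightarrow> nat) set" where
  "ev_ones = {w. \<exists>n. \<forall>k\<ge>n. w k = 1}"

lemma countable_ev_ones: "countable ev_ones"
proof -
  have "w \<in> range (\<lambda>u k. if k < length u then u ! k else 1)" if "w \<in> ev_ones" for w
  proof -
    obtain n where "\<forall>k\<ge>n. w k = 1" using \<open>w \<in> ev_ones\<close> by (auto simp: ev_ones_def)
    then have "w = (\<lambda>k. if k < length (map w [0..<n]) then map w [0..<n] ! k else 1)"
      by (auto simp: fun_eq_iff)
    then show ?thesis by blast
  qed
  then have "ev_ones \<subseteq> range (\<lambda>u k. if k < length u then u ! k else 1)" by blast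
  then show ?thesis by (rule countable_subset) auto
qed

lemma tendsto_fun_iff:
  fixes f :: "nat \<Rightarrow> nat \<Rightarrow> nat"
  shows "f \<longlonglongrightarrow> l \<longleftrightarrow> (\<forall>i. \<forall>\<^sub>F n in sequentially. f n i = l i)"
proof -
  have "f \<longlonglongrightarrow> l \<longleftrightarrow> limitin (product_topology (\<lambda>_. euclidean) UNIV) f l sequentially"
    by (metis euclidean_product_topology limitin_canonical_iff)
  also have "\<dots> \<longleftrightarrow> (\<forall>i. (\<lambda>n. f n i) \<longlonglongrightarrow> l i)"
    by (subst limitin_componentwise) simp
  finally show ?thesis by (simp add: tendsto_discrete)
qed

lemma paths_eq_glue:
  assumes "\<omega> \<in> paths x"
  shows "\<omega> = glue (\<lambda>k. \<omega> k 0) x"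
proof -
  have r0: "\<omega> 0 (Suc i) = x i" and rS: "\<omega> (Suc k) (Suc i) = \<omega> k i" for k i
    using assms unfolding paths_def r_def by (auto simp: fun_eq_iff)
  have "\<omega> k i = glue (\<lambda>k. \<omega> k 0) x k i" for k i
  proof (induction k arbitrary: i)
    case 0
    then show ?case by (cases i) (auto simp: glue_def r0)
  next
    case (Suc k)
    then show ?case by (cases i) (auto simp: glue_def rS)
  qed
  then show ?thesis by (intro ext)
qed

lemma glue_0 [simp]: "glue w x k 0 = w k"
  by (simp add: glue_def)

lemma glue_in_paths_iff: "glue w x \<in> paths x \<longleftrightarrow> (\<forall>k. glue w x k \<in> XA)"
  unfolding paths_def r_def by (auto simp: glue_def fun_eq_iff)

lemma N_C_eq: "N_C x = (\<lambda>w. glue w x) ` {w \<in> ev_ones. glue w x \<in> paths x}"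
proof (intro set_eqI iffI)
  fix \<omega> assume "\<omega> \<in> N_C x"
  then have p: "\<omega> \<in> paths x" and "\<omega> \<longlonglongrightarrow> ones" by (auto simp: N_C_def)
  then have "\<forall>\<^sub>F n in sequentially. \<omega> n 0 = 1"
    unfolding tendsto_fun_iff ones_def by blast
  then have "(\<lambda>k. \<omega> k 0) \<in> ev_ones"
    unfolding ev_ones_def eventually_sequentially by blast
  moreover have "glue (\<lambda>k. \<omega> k 0) x \<in> paths x"
    using p by (simp only: paths_eq_glue[OF p, symmetric])
  ultimately show "\<omega> \<in> (\<lambda>w. glue w x) ` {w \<in> ev_ones. glue w x \<in> paths x}"
    by (intro image_eqI[where x = "\<lambda>k. \<omega> k 0"] CollectI conjI paths_eq_glue[OF p])
next
  fix \<omega> assume "\<omega> \<in> (\<lambda>w. glue w x) ` {w \<in> ev_ones. glue w x \<in> paths x}"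
  then obtain w where w: "w \<in> ev_ones" "glue w x \<in> paths x" "\<omega> = glue w x" by blast
  obtain n where n: "\<forall>k\<ge>n. w k = 1" using w(1) by (auto simp: ev_ones_def)
  have "\<forall>\<^sub>F k in sequentially. glue w x k i = 1" for i
    unfolding eventually_sequentially
    by (rule exI[of _ "n + i"]) (use n in \<open>auto simp: glue_def\<close>)
  then show "\<omega> \<in> N_C x"
    using w by (auto simp: N_C_def tendsto_fun_iff ones_def)
qed

lemma inj_glue: "inj_on (\<lambda>w. glue w x) A"
proof (rule inj_onI)
  fix v w assume "glue v x = glue w x"
  then have "glue v x k 0 = glue w x k 0" for k by simp
  then show "v = w" by (simp add: fun_eq_iff)
qed

lemma nn_integral_N_C:
  "(\<integral>\<^sup>+\<omega>. f \<omega> \<partial>count_space (N_C x)) =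
   (\<integral>\<^sup>+w. f (glue w x) * indicator {x. glue w x \<in> paths x} x \<partial>count_space ev_ones)"
proof -
  let ?B = "{w \<in> ev_ones. glue w x \<in> paths x}"
  have "(\<integral>\<^sup>+\<omega>. f \<omega> \<partial>count_space (N_C x)) = (\<integral>\<^sup>+w. f (glue w x) \<partial>count_space ?B)"
    by (subst nn_integral_bij_count_space[symmetric, where g = "\<lambda>w. glue w x" and A = ?B])
       (auto simp: bij_betw_def inj_glue N_C_eq)
  also have "\<dots> = (\<integral>\<^sup>+w. f (glue w x) * indicator ?B w \<partial>count_space UNIV)"
    by (simp add: nn_integral_count_space_indicator)
  also have "\<dots> = (\<integral>\<^sup>+w. (f (glue w x) * indicator {x. glue w x \<in> paths x} x)
                      * indicator ev_ones w \<partial>count_space UNIV)"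
    by (intro nn_integral_cong) (auto split: split_indicator)
  also have "\<dots> = (\<integral>\<^sup>+w. f (glue w x) * indicator {x. glue w x \<in> paths x} x \<partial>count_space ev_ones)"
    by (simp add: nn_integral_count_space_indicator)
  finally show ?thesis .
qed

lemma closed_XA: "closed XA"
proof -
  have c: "continuous_on UNIV (\<lambda>x :: nat \<Rightarrow> nat. x i)" for i
    by (rule continuous_on_product_coordinates)
  have c2: "continuous_on UNIV (\<lambda>x :: nat \<Rightarrow> nat. (x i, x j))" for i j
    by (intro continuous_on_Pair c)
  let ?S = "{(a, b) \<in> letters \<times> letters. golden_A a b = 1}"
  have "finite ?S" by (rule finite_subset[of _ "letters \<times> letters"]) (auto simp: letters_def)
  then have cl: "closed ((\<lambda>x :: nat \<Rightarrow> nat. (x i, x (Suc i))) -` ?S)" for i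
    by (intro closed_vimage finite_imp_closed c2)
  have "XA = (\<Inter>i. (\<lambda>x. (x i, x (Suc i))) -` ?S)"
    by (auto simp: XA_def)
  then show ?thesis by (rule ssubst) (rule closed_INT, rule ballI, rule cl)
qed

lemma continuous_glue: "continuous_on UNIV (\<lambda>x. glue w x)"
proof -
  have "continuous_on UNIV (\<lambda>x. glue w x k i)" for k i
    by (cases "i \<le> k") (auto simp: glue_def intro: continuous_on_product_coordinates)
  then show ?thesis
    by (intro continuous_on_coordinatewise_then_product)
qed

lemma measurable_sum_N_C:
  fixes f :: "(nat \<Rightarrow> nat) \<times> path \<Rightarrow> ennreal"
  assumes sets: "sets \<rho> = sets (restrict_space borel XA)"
    and f: "f \<in> borel_measurable (restrict_space borel X_inf)"
  shows "(\<lambda>x. \<integral>\<^sup>+\<omega>. f (x, \<omega>) \<partial>count_space (N_C x)) \<in> borel_measurable \<rho>"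
proof -
  have branch: "(\<lambda>x. f (x, glue w x) * indicator {x. glue w x \<in> paths x} x) \<in> borel_measurable \<rho>"
    for w
  proof -
    let ?D = "XA \<inter> {x. glue w x \<in> paths x}"
    have "continuous_on UNIV (\<lambda>x. glue w x k)" for k
      by (rule continuous_on_product_then_coordinatewise[OF continuous_glue])
    then have cl: "closed ((\<lambda>x. glue w x k) -` XA)" for k
      by (intro closed_vimage closed_XA)
    have "{x. glue w x \<in> paths x} = (\<Inter>k. (\<lambda>x. glue w x k) -` XA)"
      by (auto simp: glue_in_paths_iff)
    then have "closed {x. glue w x \<in> paths x}"
      by (rule ssubst) (rule closed_INT, rule ballI, rule cl)
    then have D: "closed ?D" by (rule closed_Int[OF closed_XA])
    have "(\<lambda>x. (x, glue w x)) \<in> borel_measurable borel"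
      by (intro borel_measurable_continuous_onI continuous_on_Pair continuous_on_id continuous_glue)
    then have "(\<lambda>x. (x, glue w x)) \<in> measurable (restrict_space borel ?D) (restrict_space borel X_inf)"
      by (intro measurable_restrict_space2 measurable_restrict_space1)
         (auto simp: X_inf_def space_restrict_space)
    from measurable_compose[OF this f]
    have "(\<lambda>x. f (x, glue w x)) \<in> borel_measurable (restrict_space borel ?D)" .
    then have "(\<lambda>x. f (x, glue w x) * indicator ?D x) \<in> borel_measurable borel"
      by (subst (asm) borel_measurable_restrict_space_iff_ennreal) (simp_all add: borel_closed D)
    then have "(\<lambda>x. f (x, glue w x) * indicator ?D x) \<in> borel_measurable (restrict_space borel XA)"
      by (rule measurable_restrict_space1)
    then have "(\<lambda>x. f (x, glue w x) * indicator {x. glue w x \<in> paths x} x)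
        \<in> borel_measurable (restrict_space borel XA)"
      by (rule measurable_cong[THEN iffD1, rotated])
         (auto simp: space_restrict_space split: split_indicator)
    then show ?thesis
      by (simp only: measurable_cong_sets[OF sets refl])
  qed
  interpret sigma_finite_measure "count_space ev_ones"
    by (rule sigma_finite_measure_count_space_countable) (rule countable_ev_ones)
  have "(\<lambda>(w, x). f (x, glue w x) * indicator {x. glue w x \<in> paths x} x)
      \<in> borel_measurable (count_space ev_ones \<Otimes>\<^sub>M \<rho>)"
    by (rule measurable_pair_measure_countable1[OF countable_ev_ones]) (simp add: branch)
  then have "(\<lambda>(x, w). f (x, glue w x) * indicator {x. glue w x \<in> paths x} x)
      \<in> borel_measurable (\<rho> \<Otimes>\<^sub>M count_space ev_ones)"
    by (subst measurable_pair_swap_iff) (simp only: prod.case)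
  then show ?thesis
    unfolding nn_integral_N_C by (rule borel_measurable_nn_integral)
qed

lemma space_lambda_C: "space (lambda_C \<rho>) = X_inf"
  and sets_lambda_C: "sets (lambda_C \<rho>) = sets (restrict_space borel X_inf)"
proof -
  have "sets (restrict_space borel X_inf) \<subseteq> Pow X_inf"
    using sets.space_closed[of "restrict_space borel X_inf"] by (simp add: space_restrict_space)
  then show "space (lambda_C \<rho>) = X_inf" "sets (lambda_C \<rho>) = sets (restrict_space borel X_inf)"
    unfolding lambda_C_def
    by (simp_all add: space_measure_of_conv sets_measure_of
        sets.sigma_sets_eq[of "restrict_space borel X_inf", simplified space_restrict_space, simplified])
qed

lemma emeasure_lambda_C:
  assumes sets: "sets \<rho> = sets (restrict_space borel XA)"
    and E: "E \<in> sets (lambda_C \<rho>)"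
  shows "emeasure (lambda_C \<rho>) E =
    (\<integral>\<^sup>+x. (\<integral>\<^sup>+\<omega>. indicator E (x, \<omega>) \<partial>count_space (N_C x)) \<partial>\<rho>)"
proof (rule emeasure_measure_of[OF lambda_C_def])
  show "sets (restrict_space borel X_inf) \<subseteq> Pow X_inf"
    using sets.space_closed[of "restrict_space borel X_inf"] by (simp add: space_restrict_space)
  show "E \<in> sets (lambda_C \<rho>)" by fact
  show "positive (sets (lambda_C \<rho>))
    (\<lambda>E. \<integral>\<^sup>+x. (\<integral>\<^sup>+\<omega>. indicator E (x, \<omega>) \<partial>count_space (N_C x)) \<partial>\<rho>)"
    by (simp add: positive_def)
  show "countably_additive (sets (lambda_C \<rho>))
    (\<lambda>E. \<integral>\<^sup>+x. (\<integral>\<^sup>+\<omega>. indicator E (x, \<omega>) \<partial>count_space (N_C x)) \<partial>\<rho>)"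
  proof (rule countably_additiveI)
    fix F :: "nat \<Rightarrow> ((nat \<Rightarrow> nat) \<times> path) set"
    assume F: "range F \<subseteq> sets (lambda_C \<rho>)" and dis: "disjoint_family F"
    have m: "(indicator (F i) :: _ \<Rightarrow> ennreal) \<in> borel_measurable (restrict_space borel X_inf)" for i
      using F by (intro borel_measurable_indicator) (auto simp: sets_lambda_C)
    have "(\<Sum>i. \<integral>\<^sup>+x. (\<integral>\<^sup>+\<omega>. indicator (F i) (x, \<omega>) \<partial>count_space (N_C x)) \<partial>\<rho>) =
        (\<integral>\<^sup>+x. (\<Sum>i. \<integral>\<^sup>+\<omega>. indicator (F i) (x, \<omega>) \<partial>count_space (N_C x)) \<partial>\<rho>)"
      by (intro nn_integral_suminf[symmetric] measurable_sum_N_C sets m)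
    also have "\<dots> = (\<integral>\<^sup>+x. (\<integral>\<^sup>+\<omega>. (\<Sum>i. indicator (F i) (x, \<omega>)) \<partial>count_space (N_C x)) \<partial>\<rho>)"
      by (intro nn_integral_cong nn_integral_suminf[symmetric]) auto
    also have "\<dots> = (\<integral>\<^sup>+x. (\<integral>\<^sup>+\<omega>. indicator (\<Union>i. F i) (x, \<omega>) \<partial>count_space (N_C x)) \<partial>\<rho>)"
      using dis by (simp add: suminf_indicator)
    finally show "(\<Sum>i. \<integral>\<^sup>+x. (\<integral>\<^sup>+\<omega>. indicator (F i) (x, \<omega>) \<partial>count_space (N_C x)) \<partial>\<rho>) =
      (\<integral>\<^sup>+x. (\<integral>\<^sup>+\<omega>. indicator (\<Union>i. F i) (x, \<omega>) \<partial>count_space (N_C x)) \<partial>\<rho>)" .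
  qed
qed

theorem nn_integral_lambda_C:
  fixes f :: "(nat \<Rightarrow> nat) \<times> path \<Rightarrow> ennreal"
  assumes sets: "sets \<rho> = sets (restrict_space borel XA)"
    and f: "f \<in> borel_measurable (lambda_C \<rho>)"
  shows "(\<integral>\<^sup>+z. f z \<partial>lambda_C \<rho>) =
    (\<integral>\<^sup>+x. (\<integral>\<^sup>+\<omega>. f (x, \<omega>) \<partial>count_space (N_C x)) \<partial>\<rho>)"
proof -
  have ms: "borel_measurable (lambda_C \<rho>) = borel_measurable (restrict_space borel X_inf)"
    by (rule measurable_cong_sets[OF sets_lambda_C refl])
  have meas: "(\<lambda>x. \<integral>\<^sup>+\<omega>. g (x, \<omega>) \<partial>count_space (N_C x)) \<in> borel_measurable \<rho>"
    if "g \<in> borel_measurable (lambda_C \<rho>)" for g :: "(nat \<Rightarrow> nat) \<times> path \<Rightarrow> ennreal"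
    using measurable_sum_N_C[OF sets] that unfolding ms by blast
  have sp: "space \<rho> = XA"
    using sets_eq_imp_space_eq[OF sets] by (simp add: space_restrict_space)
  show ?thesis
    using f
  proof (induction rule: borel_measurable_induct)
    case (cong f g)
    have "(\<integral>\<^sup>+x. (\<integral>\<^sup>+\<omega>. f (x, \<omega>) \<partial>count_space (N_C x)) \<partial>\<rho>) =
        (\<integral>\<^sup>+x. (\<integral>\<^sup>+\<omega>. g (x, \<omega>) \<partial>count_space (N_C x)) \<partial>\<rho>)"
      by (intro nn_integral_cong cong(3)) (auto simp: space_lambda_C X_inf_def N_C_def sp)
    moreover have "(\<integral>\<^sup>+z. f z \<partial>lambda_C \<rho>) = (\<integral>\<^sup>+z. g z \<partial>lambda_C \<rho>)"
      by (intro nn_integral_cong cong(3))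
    ultimately show ?case using cong.IH cong(4) by simp
  next
    case (set E)
    then show ?case by (simp add: emeasure_lambda_C[OF sets])
  next
    case (mult u c)
    then show ?case by (simp add: nn_integral_cmult meas)
  next
    case (add u v)
    then show ?case by (simp add: nn_integral_add meas)
  next
    case (seq u)
    have inc: "incseq (\<lambda>i. u i z)" for z
      using \<open>incseq u\<close> unfolding incseq_def le_fun_def by blast
    have "(\<integral>\<^sup>+z. (SUP i. u i) z \<partial>lambda_C \<rho>) = (SUP i. \<integral>\<^sup>+z. u i z \<partial>lambda_C \<rho>)"
      unfolding SUP_apply using seq by (intro nn_integral_monotone_convergence_SUP) auto
    also have "\<dots> = (SUP i. \<integral>\<^sup>+x. (\<integral>\<^sup>+\<omega>. u i (x, \<omega>) \<partial>count_space (N_C x)) \<partial>\<rho>)"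
      using seq by simp
    also have "\<dots> = (\<integral>\<^sup>+x. (SUP i. \<integral>\<^sup>+\<omega>. u i (x, \<omega>) \<partial>count_space (N_C x)) \<partial>\<rho>)"
      using inc by (intro nn_integral_monotone_convergence_SUP[symmetric] meas seq)
        (auto simp: incseq_def le_fun_def intro!: nn_integral_mono)
    also have "\<dots> = (\<integral>\<^sup>+x. (\<integral>\<^sup>+\<omega>. (SUP i. u i) (x, \<omega>) \<partial>count_space (N_C x)) \<partial>\<rho>)"
      unfolding SUP_apply using inc
      by (intro nn_integral_cong nn_integral_monotone_convergence_SUP[symmetric])
        (auto simp: incseq_def le_fun_def)
    finally show ?case .
  qed
qed

end

theory Submission
  imports Defs "HOL-Probability.Giry_Monad"
begin

text \<open>
  The normalised filter \<open>m0 y / sqrt #r\<^sup>-\<^sup>1(r y)\<close> only takes the values \<open>1\<close> (if \<open>y\<close> starts with \<open>1\<close>) and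
  \<open>0\<close> (if \<open>y\<close> starts with \<open>2\<close>). Over every \<open>x\<close> there is exactly one path along which it never
  vanishes, the one that keeps prepending the letter \<open>1\<close>, and this path lies in \<open>N_C x\<close>. Hence the
  scaling vector is the indicator function of these paths and has norm \<open>1\<close>, while \<open>P\<^sub>x\<close> is the point
  mass on that path.
\<close>

section \<open>Letters, shift and preimages\<close>

lemma XA_letter: "x \<in> XA \<Longrightarrow> x i = 1 \<or> x i = 2"
  by (simp add: XA_def letters_def)

lemma r_in_XA: "x \<in> XA \<Longrightarrow> r x \<in> XA"
  unfolding XA_def r_def by auto

lemma r_case_nat [simp]: "r (case_nat i x) = x"
  by (simp add: r_def)

lemma case_nat_r: "case_nat (x 0) (r x) = x"
  by (auto simp: fun_eq_iff r_def split: nat.split)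

text \<open>Prepending a letter creates only one new transition, and \<open>22\<close> is the only
  forbidden one.\<close>

lemma case_nat_in_XA_iff:
  assumes "x \<in> XA"
  shows "case_nat i x \<in> XA \<longleftrightarrow> i = 1 \<or> i = 2 \<and> x 0 = 1"
proof -
  have "case_nat i x \<in> XA \<longleftrightarrow> i \<in> letters \<and> golden_A i (x 0) = 1"
    using assms unfolding XA_def by (auto split: nat.split)
  then show ?thesis
    using XA_letter[OF assms, of 0] by (auto simp: letters_def golden_A_def)
qed

lemma preimages_eq:
  assumes "x \<in> XA"
  shows "preimages x = (if x 0 = 1 then {case_nat 1 x, case_nat 2 x} else {case_nat 1 x})"
proof -
  have "preimages x = (\<lambda>i. case_nat i x) ` {i. case_nat i x \<in> XA}"
  proof (intro equalityI subsetI)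
    fix y assume "y \<in> preimages x"
    then have "y \<in> XA" and "y = case_nat (y 0) x"
      using case_nat_r[of y] by (simp_all add: preimages_def)
    then show "y \<in> (\<lambda>i. case_nat i x) ` {i. case_nat i x \<in> XA}"
      by (metis image_eqI mem_Collect_eq)
  qed (auto simp: preimages_def)
  also have "{i. case_nat i x \<in> XA} = (if x 0 = 1 then {1, 2} else {1})"
    using case_nat_in_XA_iff[OF assms] by auto
  finally show ?thesis by simp
qed

text \<open>Needed for counting: the two candidate preimages of a point differ in their first
  letter.\<close>

lemma case_nat_eq_iff: "case_nat a f = case_nat b g \<longleftrightarrow> a = b \<and> f = g"
proof
  assume eq: "case_nat a f = case_nat b g"
  have "f n = g n" for n using fun_cong[OF eq, of "Suc n"] by simp
  then show "a = b \<and> f = g" using fun_cong[OF eq, of 0] by auto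
qed simp

lemma card_preimages:
  assumes "x \<in> XA"
  shows "card (preimages x) = (if x 0 = 1 then 2 else 1)"
  using assms by (simp add: preimages_eq case_nat_eq_iff)

section \<open>The normalised filter\<close>

lemma m0_eq:
  assumes "x \<in> XA"
  shows "m0 x = of_bool (x 0 = 1) * complex_of_real (sqrt (card (preimages (r x))))"
  \<comment> \<open>The second letter of \<open>x\<close> is the first letter of \<open>r x\<close>,
    and it decides the number of preimages of \<open>r x\<close>: letter \<open>1\<close> gives two,
    letter \<open>2\<close> gives one. These are the squares of the values of \<open>m0\<close> on
    \<open>11...\<close> and \<open>12...\<close>.\<close>
  using XA_letter[OF assms, of 1] card_preimages[OF r_in_XA[OF assms]]
  by (auto simp: m0_def r_def)

lemma card_preimages_pos: "x \<in> XA \<Longrightarrow> card (preimages x) > 0"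
  by (simp add: card_preimages)

lemma normalised_m0:
  assumes "x \<in> XA"
  shows "m0 x / complex_of_real (sqrt (card (preimages (r x)))) = of_bool (x 0 = 1)"
  using m0_eq[OF assms] card_preimages_pos[OF r_in_XA[OF assms]] by simp

lemma W_m0:
  assumes "x \<in> XA"
  shows "W m0 x = of_bool (x 0 = 1)"
  using m0_eq[OF assms] card_preimages_pos[OF r_in_XA[OF assms]]
  by (simp add: W_def norm_mult power_mult_distrib)

text \<open>Only the preimage \<open>1x\<close> contributes, and its weight is exactly the number of
  preimages of \<open>x\<close>.\<close>

lemma m0_normalisation:
  assumes "x \<in> XA"
  shows "1 / real (card (preimages x)) * (\<Sum>y\<in>preimages x. (cmod (m0 y))\<^sup>2) = 1"
proof (cases "x 0 = 1")
  case True
  then show ?thesis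
    using assms by (simp add: preimages_eq case_nat_eq_iff m0_def)
next
  case False
  then have "x 0 = 2" using XA_letter[OF assms, of 0] by simp
  then show ?thesis
    using assms by (simp add: preimages_eq m0_def)
qed

section \<open>The path of ones and the infinite product\<close>

lemma ones_in_XA: "ones \<in> XA"
  by (simp add: XA_def ones_def letters_def golden_A_def)

abbreviation ones_path :: "(nat \<Rightarrow> nat) \<Rightarrow> path" where
  "ones_path \<equiv> glue ones"

lemma ones_path_in_XA:
  assumes "x \<in> XA"
  shows "ones_path x k \<in> XA"
proof -
  have "ones_path x k i \<in> letters \<and> golden_A (ones_path x k i) (ones_path x k (Suc i)) = 1" for i
  proof (cases "i \<le> k")
    case True
    then show ?thesis by (simp add: glue_def ones_def letters_def golden_A_def)
  next
    case False
    \<comment> \<open>For \<open>i > k\<close> both letters lie in \<open>x\<close> and the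
      truncated subtractions are exact. The junction \<open>i = k\<close> falls under the other
      case, where the left letter is \<open>1\<close>, which any letter may follow.\<close>
    then have "Suc i - Suc k = Suc (i - Suc k)" by simp
    with False assms show ?thesis by (simp add: glue_def XA_def)
  qed
  then show ?thesis by (simp add: XA_def)
qed

lemma ones_path_in_paths: "x \<in> XA \<Longrightarrow> ones_path x \<in> paths x"
  by (simp add: glue_in_paths_iff ones_path_in_XA)

lemma ones_path_in_N_C: "x \<in> XA \<Longrightarrow> ones_path x \<in> N_C x"
  unfolding N_C_eq
  by (intro imageI) (simp add: ones_path_in_paths ev_ones_def, simp add: ones_def)

text \<open>A path over \<open>x\<close> is determined by the first letters of its points, since
  each step only prepends a letter.\<close>

lemma paths_eq_ones_path_iff:
  assumes "\<omega> \<in> paths x"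
  shows "\<omega> = ones_path x \<longleftrightarrow> (\<forall>k. \<omega> k 0 = 1)"
proof
  assume "\<forall>k. \<omega> k 0 = 1"
  then have "(\<lambda>k. \<omega> k 0) = ones" by (simp add: ones_def fun_eq_iff)
  then show "\<omega> = ones_path x" using paths_eq_glue[OF assms] by simp
qed (simp add: ones_def)

lemma has_prod_phi_hat_m0:
  assumes "x \<in> XA" and \<omega>: "\<omega> \<in> N_C x"
  defines "f \<equiv> \<lambda>k. m0 (\<omega> k) / complex_of_real (sqrt (card (preimages (r (\<omega> k)))))"
  shows "f has_prod of_bool (\<omega> = ones_path x)"
proof -
  have p: "\<omega> \<in> paths x" using \<omega> by (simp add: N_C_def)
  then have f: "f = (\<lambda>k. of_bool (\<omega> k 0 = 1))"
    unfolding f_def by (intro ext normalised_m0) (simp add: paths_def)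
  have "\<forall>\<^sub>F n in sequentially. \<omega> n 0 = 1"
    using \<omega> unfolding N_C_def tendsto_fun_iff ones_def by blast
  then obtain N where N: "\<And>n. n \<ge> N \<Longrightarrow> \<omega> n 0 = 1"
    unfolding eventually_sequentially by blast
  \<comment> \<open>Convergence to the cycle makes all factors from \<open>N\<close> on equal to
    \<open>1\<close>; \<open>has_prod\<close> tolerates finitely many zero factors, so a vanishing
    product causes no trouble.\<close>
  have "f has_prod (\<Prod>n<N. f n)"
    using N by (intro has_prod_finite) (auto simp: f)
  also have "(\<Prod>n<N. f n) = of_bool (\<forall>k. \<omega> k 0 = 1)"
    using N by (auto simp: f) (metis lessThan_iff not_less)
  finally show ?thesis by (simp only: paths_eq_ones_path_iff[OF p])
qed

lemma phi_hat_m0: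
  assumes "x \<in> XA"
  shows "phi_hat m0 (x, \<omega>) = of_bool (\<omega> = ones_path x)"
proof (cases "\<omega> \<in> N_C x")
  case True
  show ?thesis
    by (simp only: phi_hat_def prod.case True if_True
        has_prod_unique[OF has_prod_phi_hat_m0[OF assms True], symmetric])
next
  case False
  \<comment> \<open>The default value \<open>0\<close> off \<open>N_C x\<close> is consistent with
    the indicator because \<open>ones_path x\<close> belongs to \<open>N_C x\<close>.\<close>
  then show ?thesis using ones_path_in_N_C[OF assms] by (auto simp: phi_hat_def)
qed

section \<open>The scaling identity\<close>

lemma all_nat_iff_Suc: "(\<forall>k. P k) \<longleftrightarrow> P 0 \<and> (\<forall>k. P (Suc k))"
proof (intro iffI allI)
  fix k assume "P 0 \<and> (\<forall>k. P (Suc k))"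
  then show "P k" by (cases k) simp_all
qed simp

lemma U_op_phi_hat_m0:
  assumes "z \<in> X_inf"
  shows "U_op (phi_hat m0) z = pi_op m0 (phi_hat m0) z"
proof -
  obtain x \<omega> where z: "z = (x, \<omega>)" and x: "x \<in> XA" and p: "\<omega> \<in> paths x"
    using assms by (auto simp: X_inf_def)
  have "case_nat x \<omega> \<in> paths (r x)"
    using x p by (auto simp: paths_def split: nat.split)
  \<comment> \<open>The path component of \<open>r_hat (x, \<omega>)\<close> has \<open>x\<close> as
    its first point. The extra condition \<open>x 0 = 1\<close> is the vanishing factor of
    \<open>m0 x\<close>, and the square root in \<open>U_op\<close> is its remaining factor.\<close>
  then have "case_nat x \<omega> = ones_path (r x) \<longleftrightarrow> x 0 = 1 \<and> \<omega> = ones_path x"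
    unfolding paths_eq_ones_path_iff[OF \<open>case_nat x \<omega> \<in> paths (r x)\<close>] paths_eq_ones_path_iff[OF p]
    by (subst all_nat_iff_Suc) simp
  then show ?thesis
    by (simp add: z U_op_def pi_op_def r_hat_def phi_hat_m0 x r_in_XA m0_eq)
qed

section \<open>Measurability and norm of the scaling vector\<close>

lemma borel_measurable_phi_hat_m0:
  "phi_hat m0 \<in> borel_measurable (lambda_C \<rho>)"
proof -
  \<comment> \<open>On \<open>X_inf\<close> the scaling vector is the indicator of this set, which
    is closed as an intersection of preimages of \<open>{1}\<close> under coordinate maps.\<close>
  define S where "S = {z :: (nat \<Rightarrow> nat) \<times> path. \<forall>k. snd z k 0 = 1}"
  have c: "continuous_on UNIV (\<lambda>z :: (nat \<Rightarrow> nat) \<times> path. snd z k 0)" for k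
    by (rule continuous_on_product_then_coordinatewise[OF
          continuous_on_product_then_coordinatewise[OF continuous_on_snd[OF continuous_on_id]]])
  have "closed ((\<lambda>z :: (nat \<Rightarrow> nat) \<times> path. snd z k 0) -` {1})" for k
    by (intro closed_vimage c) simp
  then have "closed (\<Inter>k. (\<lambda>z :: (nat \<Rightarrow> nat) \<times> path. snd z k 0) -` {1})"
    by (intro closed_INT ballI)
  also have "(\<Inter>k. (\<lambda>z :: (nat \<Rightarrow> nat) \<times> path. snd z k 0) -` {1}) = S"
    by (auto simp: S_def)
  finally have "closed S" .
  then have "(indicator S :: _ \<Rightarrow> complex) \<in> borel_measurable borel"
    by (intro borel_measurable_indicator borel_closed)
  then have "(indicator S :: _ \<Rightarrow> complex) \<in> borel_measurable (lambda_C \<rho>)"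
    unfolding measurable_cong_sets[OF sets_lambda_C refl] by (rule measurable_restrict_space1)
  moreover have "phi_hat m0 z = indicator S z" if "z \<in> X_inf" for z
    using that by (auto simp: X_inf_def phi_hat_m0 paths_eq_ones_path_iff S_def indicator_def)
  ultimately show ?thesis
    by (subst measurable_cong[where g = "indicator S"]) (simp_all add: space_lambda_C)
qed

lemma square_integrable_phi_hat_m0:
  assumes "prob_space \<rho>" and sets: "sets \<rho> = sets (restrict_space borel XA)"
  shows "square_integrable (lambda_C \<rho>) (phi_hat m0)"
proof -
  interpret prob_space \<rho> by fact
  note meas [measurable] = borel_measurable_phi_hat_m0[of \<rho>]
  have sp: "space \<rho> = XA"
    using sets_eq_imp_space_eq[OF sets] by (simp add: space_restrict_space)
  have "(\<integral>\<^sup>+z. ennreal ((cmod (phi_hat m0 z))\<^sup>2) \<partial>lambda_C \<rho>) =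
      (\<integral>\<^sup>+x. (\<integral>\<^sup>+\<omega>. ennreal ((cmod (phi_hat m0 (x, \<omega>)))\<^sup>2) \<partial>count_space (N_C x)) \<partial>\<rho>)"
    by (rule nn_integral_lambda_C[OF sets]) measurable
  also have "\<dots> = (\<integral>\<^sup>+x. 1 \<partial>\<rho>)"
  proof (rule nn_integral_cong)
    fix x assume "x \<in> space \<rho>"
    then have x: "x \<in> XA" by (simp add: sp)
    have "(\<integral>\<^sup>+\<omega>. ennreal ((cmod (phi_hat m0 (x, \<omega>)))\<^sup>2) \<partial>count_space (N_C x)) =
        (\<integral>\<^sup>+\<omega>. indicator {ones_path x} \<omega> \<partial>count_space (N_C x))"
      by (intro nn_integral_cong) (simp add: phi_hat_m0 x indicator_def)
    \<comment> \<open>Each fibre \<open>N_C x\<close> contains exactly one point of the support, so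
      the norm is the total mass of \<open>\<rho>\<close>.\<close>
    also have "\<dots> = 1"
      using ones_path_in_N_C[OF x] by simp
    finally show "(\<integral>\<^sup>+\<omega>. ennreal ((cmod (phi_hat m0 (x, \<omega>)))\<^sup>2) \<partial>count_space (N_C x)) = 1" .
  qed
  also have "\<dots> = 1" by (simp add: emeasure_space_1)
  finally have "(\<integral>\<^sup>+z. ennreal ((cmod (phi_hat m0 z))\<^sup>2) \<partial>lambda_C \<rho>) = 1" .
  then show ?thesis
    unfolding square_integrable_def by (auto intro!: integrableI_nonneg)
qed

section \<open>Measurable sets of paths\<close>

text \<open>Stated for a general codomain so that it applies twice: to sequences of letters, then to
  paths as sequences of such sequences.\<close>

lemma closed_singleton_fun:
  fixes f :: "'a \<Rightarrow> 'b :: topological_space"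
  assumes "\<And>i. closed {f i}"
  shows "closed {f}"
proof -
  have "closed (\<Inter>i. (\<lambda>g :: 'a \<Rightarrow> 'b. g i) -` {f i})"
    by (intro closed_INT ballI closed_vimage continuous_on_product_coordinates assms)
  also have "(\<Inter>i. (\<lambda>g :: 'a \<Rightarrow> 'b. g i) -` {f i}) = {f}"
    by (auto simp: fun_eq_iff)
  finally show ?thesis .
qed

lemma closed_singleton_seq: "closed {a :: nat \<Rightarrow> nat}"
  by (rule closed_singleton_fun) simp

lemma path_singleton_in_sets:
  assumes "\<omega> \<in> paths x"
  shows "{\<omega>} \<in> sets (restrict_space borel (paths x))"
proof -
  have "{\<omega>} \<in> sets borel"
    by (intro borel_closed closed_singleton_fun closed_singleton_seq)
  then show ?thesis
    using assms by (auto simp: sets_restrict_space intro!: image_eqI[where x = "{\<omega>}"])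
qed

lemma closed_path_cylinder: "closed {\<omega> :: path. \<forall>k<n. \<omega> k = a k}"
proof -
  have "closed ((\<lambda>\<omega> :: path. \<omega> k) -` {a k})" for k
    by (intro closed_vimage continuous_on_product_coordinates closed_singleton_seq)
  then have "closed (\<Inter>k\<in>{..<n}. (\<lambda>\<omega> :: path. \<omega> k) -` {a k})"
    by (intro closed_INT ballI)
  also have "(\<Inter>k\<in>{..<n}. (\<lambda>\<omega> :: path. \<omega> k) -` {a k}) = {\<omega>. \<forall>k<n. \<omega> k = a k}"
    by auto
  finally show ?thesis .
qed

lemma path_cylinder_in_sets:
  "{\<omega> \<in> paths x. \<forall>k<n. \<omega> k = a k} \<in> sets (restrict_space borel (paths x))"
proof -
  have "paths x \<inter> {\<omega>. \<forall>k<n. \<omega> k = a k} \<in> sets (restrict_space borel (paths x))"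
    unfolding sets_restrict_space by (intro imageI borel_closed closed_path_cylinder)
  then show ?thesis by (simp only: Int_def mem_Collect_eq)
qed

text \<open>The point with index \<open>k\<close> is the word of prepended letters \<open>0\<close>
  to \<open>k\<close>, read backwards and followed by \<open>x\<close>; so these letters determine
  it.\<close>

lemma paths_eq_below_iff:
  assumes "a \<in> paths x" "b \<in> paths x"
  shows "(\<forall>k<n. a k = b k) \<longleftrightarrow> (\<forall>k<n. a k 0 = b k 0)"
proof
  assume "\<forall>k<n. a k 0 = b k 0"
  then have "glue (\<lambda>k. a k 0) x k = glue (\<lambda>k. b k 0) x k" if "k < n" for k
    using that by (auto simp: glue_def fun_eq_iff)
  then show "\<forall>k<n. a k = b k"
    using paths_eq_glue[OF assms(1)] paths_eq_glue[OF assms(2)] by simp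
qed simp

section \<open>The path measures and the value of \<open>h_C\<close>\<close>

lemma prod_W_m0:
  assumes "x \<in> XA" "a \<in> paths x"
  shows "(\<Prod>k<n. W m0 (a k)) = of_bool (\<forall>k<n. ones_path x k = a k)"
proof -
  have "(\<Prod>k<n. W m0 (a k)) = (\<Prod>k<n. of_bool (a k 0 = 1))"
    using assms by (intro prod.cong refl W_m0) (simp add: paths_def)
  also have "\<dots> = of_bool (\<forall>k<n. a k 0 = 1)"
    by auto
  also have "(\<forall>k<n. a k 0 = 1) \<longleftrightarrow> (\<forall>k<n. ones_path x k = a k)"
    using paths_eq_below_iff[OF ones_path_in_paths assms(2), of n] assms(1)
    by (auto simp: ones_def)
  finally show ?thesis .
qed

text \<open>The cylinder weights from \<open>prod_W_m0\<close> are those of the point mass at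
  \<open>ones_path x\<close>.\<close>

lemma is_path_measure_m0:
  assumes x: "x \<in> XA"
  shows "is_path_measure m0 x (return (restrict_space borel (paths x)) (ones_path x))"
proof -
  have "prob_space (return (restrict_space borel (paths x)) (ones_path x))"
    using ones_path_in_paths[OF x] by (intro prob_space_return) (simp add: space_restrict_space)
  moreover have "measure (return (restrict_space borel (paths x)) (ones_path x))
      {\<omega> \<in> paths x. \<forall>k<n. \<omega> k = a k} = (\<Prod>k<n. W m0 (a k))" if "a \<in> paths x" for a n
    using ones_path_in_paths[OF x]
    by (simp add: measure_def path_cylinder_in_sets prod_W_m0[OF x that] indicator_def)
  ultimately show ?thesis
    by (simp add: is_path_measure_def)
qed

lemma (in prob_space) prob_singleton_1_imp_eq_return:
  assumes "{a} \<in> sets M" "prob {a} = 1"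
  shows "M = return M a"
proof (rule measure_eqI)
  fix A assume A: "A \<in> sets M"
  have "prob A = indicator A a"
  proof (cases "a \<in> A")
    case True
    then have "prob {a} \<le> prob A" by (intro finite_measure_mono A) simp
    then show ?thesis using True assms(2) prob_le_1[of A] by simp
  next
    case False
    \<comment> \<open>If \<open>A\<close> misses \<open>a\<close>, adding \<open>a\<close> raises
      the probability by \<open>1\<close>, which forces \<open>A\<close> to be null.\<close>
    then have "prob (A \<union> {a}) = prob A + prob {a}"
      by (intro finite_measure_Union A assms) simp
    then show ?thesis
      using False assms(2) prob_le_1[of "A \<union> {a}"] measure_nonneg[of M A] by simp
  qed
  then show "emeasure M A = emeasure (return M a) A"
    using A by (simp add: emeasure_eq_measure split: split_indicator)
qed simp

text \<open>The cylinders around \<open>ones_path x\<close> all have probability \<open>1\<close>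
  and decrease to that single path, so continuity from above gives it full mass.\<close>

lemma is_path_measure_m0_unique:
  assumes x: "x \<in> XA" and P: "is_path_measure m0 x P"
  shows "P = return (restrict_space borel (paths x)) (ones_path x)"
proof -
  interpret prob_space P using P by (simp add: is_path_measure_def)
  have sets: "sets P = sets (restrict_space borel (paths x))"
    using P by (simp add: is_path_measure_def)
  note o = ones_path_in_paths[OF x]
  let ?Z = "\<lambda>n. {\<omega> \<in> paths x. \<forall>k<n. \<omega> k = ones_path x k}"
  have "prob (?Z n) = 1" for n
    using P o by (simp add: is_path_measure_def prod_W_m0[OF x o])
  moreover have "(\<lambda>n. prob (?Z n)) \<longlonglongrightarrow> prob (\<Inter>n. ?Z n)"
    by (intro finite_Lim_measure_decseq)
       (auto simp: sets path_cylinder_in_sets decseq_def)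
  moreover have "(\<Inter>n. ?Z n) = {ones_path x}"
  proof (intro equalityI subsetI)
    fix \<omega> assume "\<omega> \<in> (\<Inter>n. ?Z n)"
    then have "\<omega> k = ones_path x k" for k by blast
    then show "\<omega> \<in> {ones_path x}" by (simp add: ext)
  qed (use o in simp)
  ultimately have "prob {ones_path x} = 1"
    by (simp add: LIMSEQ_const_iff)
  then have "P = return P (ones_path x)"
    using path_singleton_in_sets[OF o]
    by (intro prob_singleton_1_imp_eq_return) (simp_all only: sets)
  \<comment> \<open>\<open>return\<close> depends on its first argument only through the
    sigma-algebra.\<close>
  also have "\<dots> = return (restrict_space borel (paths x)) (ones_path x)"
    by (rule fun_cong[OF return_sets_cong[OF sets]])
  finally show ?thesis .
qed

lemma h_C_m0:
  assumes x: "x \<in> XA"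
  shows "h_C m0 x = 1"
proof -
  \<comment> \<open>Existence and uniqueness together resolve the definite description.\<close>
  have "path_measure m0 x = return (restrict_space borel (paths x)) (ones_path x)"
    unfolding path_measure_def
    by (intro the_equality is_path_measure_m0 is_path_measure_m0_unique x)
  \<comment> \<open>Measurability matters, as a non-measurable set would get measure
    \<open>0\<close> by default; it holds because \<open>N_C x\<close> is a countable union of
    singletons.\<close>
  moreover have "N_C x \<in> sets (restrict_space borel (paths x))"
  proof (rule sets.countable)
    show "countable (N_C x)"
      unfolding N_C_eq by (intro countable_image countable_subset[OF _ countable_ev_ones]) auto
  qed (auto simp: N_C_def intro: path_singleton_in_sets)
  ultimately show ?thesis
    using ones_path_in_N_C[OF x] by (simp add: h_C_def measure_def)
qed

theorem proposition2p18:
  fixes \<rho> :: "(nat \<Rightarrow> nat) measure"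
  assumes "strongly_invariant \<rho>"
  shows "(\<forall>x\<in>XA. 1 / real (card (preimages x)) * (\<Sum>y\<in>preimages x. (cmod (m0 y))\<^sup>2) = 1)
       \<and> m0 ones = complex_of_real (sqrt (card (preimages (r ones))))
       \<and> (\<forall>x\<in>XA. \<forall>\<omega>\<in>N_C x.
            (\<lambda>k. m0 (\<omega> k) / complex_of_real (sqrt (card (preimages (r (\<omega> k))))))
              has_prod phi_hat m0 (x, \<omega>))
       \<and> square_integrable (lambda_C \<rho>) (phi_hat m0)
       \<and> (AE z in lambda_C \<rho>. U_op (phi_hat m0) z = pi_op m0 (phi_hat m0) z)
       \<and> (\<forall>x\<in>XA. h_C m0 x = 1)"
proof (intro conjI ballI)
  show "m0 ones = complex_of_real (sqrt (card (preimages (r ones))))"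
    using m0_eq[OF ones_in_XA] by (simp add: ones_def)
  show "square_integrable (lambda_C \<rho>) (phi_hat m0)"
    using assms by (simp add: strongly_invariant_def square_integrable_phi_hat_m0)
  \<comment> \<open>The identity holds at every point of \<open>X_inf\<close>, which is the whole
    space of \<open>lambda_C \<rho>\<close>.\<close>
  show "AE z in lambda_C \<rho>. U_op (phi_hat m0) z = pi_op m0 (phi_hat m0) z"
    by (intro AE_I2) (simp add: space_lambda_C U_op_phi_hat_m0)
next
  fix x \<omega> assume "x \<in> XA" "\<omega> \<in> N_C x"
  then show "(\<lambda>k. m0 (\<omega> k) / complex_of_real (sqrt (card (preimages (r (\<omega> k))))))
      has_prod phi_hat m0 (x, \<omega>)"
    unfolding phi_hat_m0[OF \<open>x \<in> XA\<close>] by (rule has_prod_phi_hat_m0)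
qed (fact m0_normalisation h_C_m0)+

end
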